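(* Let $a_1,b_1,a_2,b_2\in\mathbb{R}^4$ be pairwise orthogonal with $|a_k|=|b_k|$ for $k=1,2$, and let $\phi_1>\phi_2>0$. Let $\gamma(s,a,b,\phi)=(x(s,a,b,\phi),t(s,a,b,\phi))$ be the extremal with control $u(s)=a_1\cos(2\phi_1 s)+b_1\sin(2\phi_1 s)+a_2\cos(2\phi_2 s)+b_2\sin(2\phi_2 s)$. For $k=1,2$ set $$\alpha_k=a_k\sin\phi_k-b_k\cos\phi_k,\qquad \beta_k=a_k\cos\phi_k+b_k\sin\phi_k .$$ Then $$x(1,a,b,\phi)=T(\phi_1)\beta_1+T(\phi_2)\beta_2,$$ $$t(1,a,b,\phi)=U(\phi_1)\,\alpha_1\wedge\beta_1+Z(\phi_1,\phi_2)\,\alpha_1\wedge\beta_2+Z(\phi_2,\phi_1)\,\alpha_2\wedge\beta_1+U(\phi_2)\,\alpha_2\wedge\beta_2 .$$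
   Context: Given a control $u:\mathbb{R}\to\mathbb{R}^4$, the associated curve $(x,t):\mathbb{R}\to\mathbb{R}^4\times\Lambda^2\mathbb{R}^4$ is the solution of $\dot x=u$, $\dot t=\frac12 x\wedge u$ with $(x(0),t(0))=(0,0)$; the extremal $\gamma(\cdot,a,b,\phi)$ is the curve associated with the control $u$ in the statement. The functions are $$T(\phi)=\frac{\sin\phi}{\phi},\qquad U(\phi)=\frac{\phi-\sin\phi\cos\phi}{4\phi^2}\qquad(\phi>0),$$ $$Z(x,y)=\frac{y\cos y\sin x-x\cos x\sin y}{2y(x^2-y^2)}\qquad(x,y>0,\ x\ne y).$$ *)

theory Defs
  imports "HOL-Analysis.Analysis"
begin

(* The exterior square of \<real>^4 is modelled by the skew-symmetric 4x4 matrices, with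
   (v \<and> w) having entries v_i w_j - w_i v_j. The lemmas Lambda2_eq_span and
   wedge_universal show that this is an exterior square of \<real>^4 in the sense of the
   universal property. *)

definition Lambda2 :: "(real^4^4) set" where
  "Lambda2 = {A. transpose A = - A}"

definition wedge :: "real^4 \<Rightarrow> real^4 \<Rightarrow> real^4^4"  (infixl \<open>\<and>\<^sub>\<Lambda>\<close> 76) where
  "v \<and>\<^sub>\<Lambda> w = (\<chi> i j. v $ i * w $ j - w $ i * v $ j)"

lemma bounded_bilinear_wedge: "bounded_bilinear wedge"
proof -
  have "bilinear wedge"
    unfolding bilinear_def
    by (auto intro!: linearI simp: wedge_def vec_eq_iff algebra_simps)
  then show ?thesis
    by (simp add: bilinear_conv_bounded_bilinear)
qed

lemma wedge_self: "v \<and>\<^sub>\<Lambda> v = 0"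
  by (simp add: wedge_def vec_eq_iff)

lemma subspace_Lambda2: "subspace Lambda2"
proof -
  have "linear (transpose :: real^4^4 \<Rightarrow> _)"
    by (rule linearI) (simp_all add: transpose_def vec_eq_iff)
  then show ?thesis
    by (simp add: subspace_def Lambda2_def linear_0 linear_add linear_cmul)
qed

lemma wedge_in_Lambda2: "v \<and>\<^sub>\<Lambda> w \<in> Lambda2"
  by (simp add: wedge_def Lambda2_def transpose_def vec_eq_iff)

lemma Lambda2_expand:
  assumes "A \<in> Lambda2"
  shows "A = (\<Sum>i\<in>UNIV. \<Sum>j\<in>UNIV. (A $ i $ j / 2) *\<^sub>R (axis i 1 \<and>\<^sub>\<Lambda> axis j 1))"
proof -
  have skew: "A $ l $ k = - A $ k $ l" for k l
  proof -
    have "transpose A $ k $ l = (- A) $ k $ l"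
      using assms by (simp only: Lambda2_def mem_Collect_eq)
    then show ?thesis
      by (simp only: transpose_def vec_lambda_beta uminus_vec_def)
  qed
  have "(\<Sum>i\<in>UNIV. \<Sum>j\<in>UNIV. (A $ i $ j / 2) *\<^sub>R (axis i 1 \<and>\<^sub>\<Lambda> axis j 1)) $ k $ l
      = A $ k $ l" for k l
  proof -
    have ax: "axis i 1 $ m = (if i = m then 1 else (0::real))" for i m :: 4
      by (simp add: axis_def)
    have "(\<Sum>j\<in>UNIV. A $ i $ j / 2 * (axis i 1 $ k * axis j 1 $ l - axis j 1 $ k * axis i 1 $ l))
        = (if i = k then A $ i $ l / 2 else 0) - (if i = l then A $ i $ k / 2 else 0)" for i
      by (simp add: ax right_diff_distrib sum_subtractf if_distrib[of "(*) _"] cong: if_cong)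
    then show ?thesis
      using skew[of l k] by (simp add: wedge_def sum_subtractf)
  qed
  then show ?thesis
    by (simp add: vec_eq_iff)
qed

lemma Lambda2_eq_span: "Lambda2 = span {v \<and>\<^sub>\<Lambda> w |v w. True}"
proof
  show "span {v \<and>\<^sub>\<Lambda> w |v w. True} \<subseteq> Lambda2"
    by (rule span_minimal) (auto simp: wedge_in_Lambda2 subspace_Lambda2)
  show "Lambda2 \<subseteq> span {v \<and>\<^sub>\<Lambda> w |v w. True}"
  proof
    fix A assume "A \<in> Lambda2"
    then have "A = (\<Sum>i\<in>UNIV. \<Sum>j\<in>UNIV. (A $ i $ j / 2) *\<^sub>R (axis i 1 \<and>\<^sub>\<Lambda> axis j 1))"
      by (rule Lambda2_expand)
    also have "\<dots> \<in> span {v \<and>\<^sub>\<Lambda> w |v w. True}"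
      by (intro span_sum span_scale span_base) auto
    finally show "A \<in> span {v \<and>\<^sub>\<Lambda> w |v w. True}" .
  qed
qed

lemma wedge_universal:
  fixes B :: "real^4 \<Rightarrow> real^4 \<Rightarrow> 'a::real_vector"
  assumes B: "bilinear B" and alt: "\<And>v. B v v = 0"
  shows "\<exists>L. linear L \<and> (\<forall>v w. L (v \<and>\<^sub>\<Lambda> w) = B v w)"
proof -
  define L :: "real^4^4 \<Rightarrow> 'a" where
    "L = (\<lambda>A. \<Sum>i\<in>UNIV. \<Sum>j\<in>UNIV. (A $ i $ j / 2) *\<^sub>R B (axis i 1) (axis j 1))"
  have l1: "linear (\<lambda>v. B v w)" and l2: "linear (B v)" for v w
    using B by (auto simp: bilinear_def)
  have expand: "v = (\<Sum>i\<in>UNIV. v $ i *\<^sub>R axis i 1)" for v :: "real^4"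
    by (metis basis_expansion scalar_mult_eq_scaleR)
  have Bexp: "B v w = (\<Sum>i\<in>UNIV. \<Sum>j\<in>UNIV. (v $ i * w $ j) *\<^sub>R B (axis i 1) (axis j 1))" for v w
  proof -
    have "B v w = B (\<Sum>i\<in>UNIV. v $ i *\<^sub>R axis i 1) w"
      using expand[of v] by simp
    also have "\<dots> = (\<Sum>i\<in>UNIV. v $ i *\<^sub>R B (axis i 1) w)"
      by (simp add: linear_sum[OF l1] linear_cmul[OF l1])
    also have "\<dots> = (\<Sum>i\<in>UNIV. v $ i *\<^sub>R B (axis i 1) (\<Sum>j\<in>UNIV. w $ j *\<^sub>R axis j 1))"
      using expand[of w] by simp
    finally show ?thesis
      by (simp add: linear_sum[OF l2] linear_cmul[OF l2] scaleR_sum_right)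
  qed
  have antisym: "B w v = - B v w" for v w
  proof -
    have "B (v + w) (v + w) = B v v + B v w + (B w v + B w w)"
      by (simp add: linear_add[OF l1] linear_add[OF l2])
    then show ?thesis
      using alt by (simp add: eq_neg_iff_add_eq_0 add.commute)
  qed
  have "linear L"
    unfolding L_def
    by (rule linearI)
      (simp_all add: add_divide_distrib scaleR_add_left sum.distrib scaleR_sum_right)
  moreover have "L (v \<and>\<^sub>\<Lambda> w) = B v w" for v w
  proof -
    have "L (v \<and>\<^sub>\<Lambda> w) = (1/2) *\<^sub>R (B v w - B w v)"
      unfolding L_def Bexp[of v w] Bexp[of w v]
      by (simp add: wedge_def scaleR_sum_right sum_subtractf[symmetric]
          scaleR_diff_left[symmetric] mult.commute diff_divide_distrib)
    also have "\<dots> = B v w"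
      using antisym[of w v] by (simp add: scaleR_2[symmetric])
    finally show ?thesis .
  qed
  ultimately show ?thesis by blast
qed

definition solves_control :: "(real \<Rightarrow> real^4) \<Rightarrow> (real \<Rightarrow> (real^4) \<times> (real^4^4)) \<Rightarrow> bool" where
  "solves_control u \<gamma> \<longleftrightarrow>
     range \<gamma> \<subseteq> UNIV \<times> Lambda2 \<and>
     \<gamma> 0 = (0, 0) \<and>
     (\<forall>s. ((\<lambda>s. fst (\<gamma> s)) has_vector_derivative u s) (at s)) \<and>
     (\<forall>s. ((\<lambda>s. snd (\<gamma> s)) has_vector_derivative (1/2) *\<^sub>R (fst (\<gamma> s) \<and>\<^sub>\<Lambda> u s)) (at s))"

(* Meaningful for continuous controls, see solves_control_ex1. *)
definition associated_curve :: "(real \<Rightarrow> real^4) \<Rightarrow> real \<Rightarrow> (real^4) \<times> (real^4^4)" where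
  "associated_curve u = (THE \<gamma>. solves_control u \<gamma>)"

lemma antiderivative_ex:
  fixes f :: "real \<Rightarrow> 'a::euclidean_space"
  assumes "continuous_on UNIV f"
  shows "\<exists>F. F 0 = 0 \<and> (\<forall>s. (F has_vector_derivative f s) (at s))"
proof -
  let ?F = "\<lambda>u. LBINT y=ereal 0..ereal u. f y"
  have "(?F has_vector_derivative f s) (at s)" for s
  proof -
    let ?a = "- \<bar>s\<bar> - 1" and ?b = "\<bar>s\<bar> + 1"
    have "(?F has_vector_derivative f s) (at s within {?a..?b})"
      by (rule interval_integral_FTC2) (auto intro: continuous_on_subset[OF assms])
    then have "(?F has_vector_derivative f s) (at s within {?a<..<?b})"
      by (rule has_vector_derivative_within_subset) auto
    moreover have "s \<in> {?a<..<?b}"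
      by auto
    ultimately show ?thesis
      by (simp only: has_vector_derivative_within_open open_greaterThanLessThan)
  qed
  moreover have "?F 0 = 0"
    by simp
  ultimately show ?thesis
    by (intro exI[of _ ?F]) simp
qed

lemma antiderivative_unique:
  fixes F G :: "real \<Rightarrow> 'a::real_normed_vector"
  assumes "\<And>s. (F has_vector_derivative f s) (at s)" "\<And>s. (G has_vector_derivative f s) (at s)"
    and "F 0 = G 0"
  shows "F = G"
proof
  fix s
  have "((\<lambda>s. F s - G s) has_vector_derivative 0) (at s within UNIV)" for s
    using has_vector_derivative_diff[OF assms(1)[of s] assms(2)[of s]] by simp
  then obtain c where "\<And>s. F s - G s = c"
    using has_vector_derivative_zero_constant[of UNIV "\<lambda>s. F s - G s"] by auto
  then show "F s = G s"
    using assms(3) by (metis diff_self eq_iff_diff_eq_0)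
qed

lemma solves_control_ex1:
  assumes u: "continuous_on UNIV u"
  shows "\<exists>!\<gamma>. solves_control u \<gamma>"
proof -
  obtain x where x: "x 0 = 0" "\<And>s. (x has_vector_derivative u s) (at s)"
    using antiderivative_ex[OF u] by blast
  have cx: "continuous_on UNIV x"
    using x(2) by (meson continuous_at_imp_continuous_on has_vector_derivative_continuous)
  have "continuous_on UNIV (\<lambda>s. (1/2) *\<^sub>R (x s \<and>\<^sub>\<Lambda> u s))"
    by (intro continuous_intros bounded_bilinear.continuous_on[OF bounded_bilinear_wedge] cx u)
  then obtain t where t: "t 0 = 0"
      "\<And>s. (t has_vector_derivative (1/2) *\<^sub>R (x s \<and>\<^sub>\<Lambda> u s)) (at s)"
    using antiderivative_ex by blast
  have bl: "bounded_linear (\<lambda>A :: real^4^4. - transpose A)"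
    unfolding linear_conv_bounded_linear[symmetric]
    by (rule linearI) (simp_all add: transpose_def vec_eq_iff)
  have "((\<lambda>s. - transpose (t s)) has_vector_derivative (1/2) *\<^sub>R (x s \<and>\<^sub>\<Lambda> u s)) (at s)" for s
  proof -
    have "- transpose ((1/2) *\<^sub>R (x s \<and>\<^sub>\<Lambda> u s)) = (1/2) *\<^sub>R (x s \<and>\<^sub>\<Lambda> u s)"
      by (simp add: wedge_def transpose_def vec_eq_iff field_simps)
    then show ?thesis
      using bounded_linear.has_vector_derivative[OF bl t(2)[of s]] by simp
  qed
  then have "(\<lambda>s. - transpose (t s)) = t"
    by (rule antiderivative_unique[OF _ t(2)]) (simp add: t(1) transpose_def vec_eq_iff)
  then have "t s \<in> Lambda2" for s
    unfolding Lambda2_def by (metis (mono_tags, lifting) mem_Collect_eq minus_minus)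
  then have ex: "solves_control u (\<lambda>s. (x s, t s))"
    using x t by (auto simp: solves_control_def)
  have "\<gamma> = (\<lambda>s. (x s, t s))" if \<gamma>: "solves_control u \<gamma>" for \<gamma>
  proof -
    have 1: "(\<lambda>s. fst (\<gamma> s)) = x"
      by (rule antiderivative_unique[of _ u]) (use \<gamma> x in \<open>auto simp: solves_control_def\<close>)
    have 2: "fst (\<gamma> s) = x s" for s
      using fun_cong[OF 1] by simp
    have 3: "(\<lambda>s. snd (\<gamma> s)) = t"
      by (rule antiderivative_unique[of _ "\<lambda>s. (1/2) *\<^sub>R (x s \<and>\<^sub>\<Lambda> u s)"])
        (use \<gamma> t 2 in \<open>auto simp: solves_control_def\<close>)
    show ?thesis
      using 2 fun_cong[OF 3] by (auto simp: prod_eq_iff)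
  qed
  with ex show ?thesis by blast
qed

definition extremal_control ::
  "(real^4) \<times> (real^4) \<Rightarrow> (real^4) \<times> (real^4) \<Rightarrow> real \<times> real \<Rightarrow> real \<Rightarrow> real^4" where
  "extremal_control = (\<lambda>(a1, a2) (b1, b2) (\<phi>1, \<phi>2) s.
     cos (2 * \<phi>1 * s) *\<^sub>R a1 + sin (2 * \<phi>1 * s) *\<^sub>R b1 +
     cos (2 * \<phi>2 * s) *\<^sub>R a2 + sin (2 * \<phi>2 * s) *\<^sub>R b2)"

definition extremal ::
  "real \<Rightarrow> (real^4) \<times> (real^4) \<Rightarrow> (real^4) \<times> (real^4) \<Rightarrow> real \<times> real \<Rightarrow> (real^4) \<times> (real^4^4)" where
  "extremal s a b \<phi> = associated_curve (extremal_control a b \<phi>) s"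

definition extremal_x ::
  "real \<Rightarrow> (real^4) \<times> (real^4) \<Rightarrow> (real^4) \<times> (real^4) \<Rightarrow> real \<times> real \<Rightarrow> real^4" where
  "extremal_x s a b \<phi> = fst (extremal s a b \<phi>)"

definition extremal_t ::
  "real \<Rightarrow> (real^4) \<times> (real^4) \<Rightarrow> (real^4) \<times> (real^4) \<Rightarrow> real \<times> real \<Rightarrow> real^4^4" where
  "extremal_t s a b \<phi> = snd (extremal s a b \<phi>)"

definition T :: "real \<Rightarrow> real" where
  "T \<phi> = sin \<phi> / \<phi>"

definition U :: "real \<Rightarrow> real" where
  "U \<phi> = (\<phi> - sin \<phi> * cos \<phi>) / (4 * \<phi>\<^sup>2)"

definition Z :: "real \<Rightarrow> real \<Rightarrow> real" where
  "Z x y = (y * cos y * sin x - x * cos x * sin y) / (2 * y * (x\<^sup>2 - y\<^sup>2))"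

end

theory Submission
  imports Defs
begin

text \<open>
  The vectors \<open>\<alpha>\<^sub>k\<close> and \<open>\<beta>\<^sub>k\<close> are what the control looks like from the midpoint \<open>s = 1/2\<close>: there the
  \<open>k\<close>-th component of \<open>u\<close> is \<open>\<beta>\<^sub>k\<close>, its velocity is a negative multiple of \<open>\<alpha>\<^sub>k\<close>, and in the centred phase
  \<open>\<theta>\<^sub>k = \<phi>\<^sub>k (2 s - 1)\<close> the component is \<open>cos \<theta>\<^sub>k \<beta>\<^sub>k - sin \<theta>\<^sub>k \<alpha>\<^sub>k\<close> (\<open>rotation_centred\<close>). Integrating
  from \<open>0\<close> gives \<open>x\<close> with coefficient \<open>(sin \<theta>\<^sub>k + sin \<phi>\<^sub>k) / (2 \<phi>\<^sub>k)\<close> on \<open>\<beta>\<^sub>k\<close> and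
  \<open>(cos \<theta>\<^sub>k - cos \<phi>\<^sub>k) / (2 \<phi>\<^sub>k)\<close> on \<open>\<alpha>\<^sub>k\<close>. As \<open>\<theta>\<^sub>k = \<phi>\<^sub>k\<close> at \<open>s = 1\<close>, the second coefficient vanishes
  there and the first is \<open>T \<phi>\<^sub>k\<close>.

  For \<open>t\<close>, expand \<open>x \<and> u\<close> in the six wedges of \<open>\<alpha>\<^sub>1, \<beta>\<^sub>1, \<alpha>\<^sub>2, \<beta>\<^sub>2\<close> and integrate the coefficients over
  \<open>[0, 1]\<close>, that is, over symmetric ranges of the phases. The coefficient of \<open>\<alpha>\<^sub>1 \<and> \<alpha>\<^sub>2\<close> is odd in the
  phases, and the even part of the coefficient of \<open>\<beta>\<^sub>1 \<and> \<beta>\<^sub>2\<close> has mean zero, so these two wedges do not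
  contribute to \<open>t\<close> at time \<open>1\<close>. The other four have
  coefficients \<open>U\<close> (for equal indices) and \<open>Z\<close> (for different indices); these follow from the elementary
  integrals of \<open>cos \<theta>\<^sub>1 cos \<theta>\<^sub>2\<close> and \<open>sin \<theta>\<^sub>1 sin \<theta>\<^sub>2\<close>.
\<close>

text \<open>An explicit formula is needed for \<open>x\<close> at all times, as it enters the integrand of \<open>t\<close>, but for \<open>t\<close>
  only a definite integral. This makes it possible to drop the terms that are odd about \<open>1/2\<close>.\<close>

lemma associated_curve_at_1:
  assumes u: "continuous_on UNIV u"
    and x: "x 0 = 0" "\<And>s. (x has_vector_derivative u s) (at s)"
    and t: "((\<lambda>s. (1/2) *\<^sub>R (x s \<and>\<^sub>\<Lambda> u s)) has_integral I) {0..1}"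
  shows "associated_curve u 1 = (x 1, I)"
proof -
  let ?\<gamma> = "associated_curve u"
  have \<gamma>: "solves_control u ?\<gamma>"
    unfolding associated_curve_def using solves_control_ex1[OF u] by (rule theI')
  have "(\<lambda>s. fst (?\<gamma> s)) = x"
    by (rule antiderivative_unique[of _ u]) (use \<gamma> x in \<open>auto simp: solves_control_def\<close>)
  then have fst_eq: "fst (?\<gamma> s) = x s" for s
    by (rule fun_cong)
  have "((\<lambda>s. (1/2) *\<^sub>R (x s \<and>\<^sub>\<Lambda> u s)) has_integral snd (?\<gamma> 1) - snd (?\<gamma> 0)) {0..1}"
    by (rule fundamental_theorem_of_calculus)
      (use \<gamma> fst_eq in \<open>auto simp: solves_control_def intro: has_vector_derivative_at_within\<close>)
  then have "snd (?\<gamma> 1) = I"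
    using has_integral_unique[OF t] \<gamma> by (simp add: solves_control_def)
  with fst_eq show ?thesis
    by (simp add: prod_eq_iff)
qed

text \<open>In the phase \<open>p (2 s - 1)\<close> the time interval becomes symmetric about \<open>0\<close>, so that parity decides which
  integrals vanish; the vectors on the right are the \<open>\<beta>\<close> and \<open>\<alpha>\<close> of the pair \<open>a, b\<close>.\<close>

lemma rotation_centred:
  fixes a b :: "'a::real_vector"
  shows "cos (2 * p * s) *\<^sub>R a + sin (2 * p * s) *\<^sub>R b =
    cos (p * (2 * s - 1)) *\<^sub>R (cos p *\<^sub>R a + sin p *\<^sub>R b) -
    sin (p * (2 * s - 1)) *\<^sub>R (sin p *\<^sub>R a - cos p *\<^sub>R b)"
proof -
  have eq: "2 * p * s = p * (2 * s - 1) + p"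
    by (simp add: algebra_simps)
  show ?thesis
    unfolding eq cos_add sin_add by (simp add: algebra_simps)
qed

text \<open>The coordinates of \<open>x\<close> along \<open>\<beta>\<close> and \<open>\<alpha>\<close>: antiderivatives of those of the centred control, with
  the constants \<open>sin p\<close> and \<open>cos p\<close> chosen so that they vanish at \<open>s = 0\<close>.\<close>

definition beta_coeff :: "real \<Rightarrow> real \<Rightarrow> real" where
  "beta_coeff p s = (sin (p * (2 * s - 1)) + sin p) / (2 * p)"

definition alpha_coeff :: "real \<Rightarrow> real \<Rightarrow> real" where
  "alpha_coeff p s = (cos (p * (2 * s - 1)) - cos p) / (2 * p)"

lemma beta_coeff_deriv:
  "p \<noteq> 0 \<Longrightarrow> (beta_coeff p has_real_derivative cos (p * (2 * s - 1))) (at s)"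
  unfolding beta_coeff_def by (auto intro!: derivative_eq_intros)

lemma alpha_coeff_deriv:
  "p \<noteq> 0 \<Longrightarrow> (alpha_coeff p has_real_derivative - sin (p * (2 * s - 1))) (at s)"
  unfolding alpha_coeff_def by (auto intro!: derivative_eq_intros)

lemma wedge_expansion:
  "(m1 *\<^sub>R \<beta>1 + n1 *\<^sub>R \<alpha>1 + m2 *\<^sub>R \<beta>2 + n2 *\<^sub>R \<alpha>2) \<and>\<^sub>\<Lambda>
   (c1 *\<^sub>R \<beta>1 - s1 *\<^sub>R \<alpha>1 + (c2 *\<^sub>R \<beta>2 - s2 *\<^sub>R \<alpha>2)) =
   (n1 * c1 + m1 * s1) *\<^sub>R (\<alpha>1 \<and>\<^sub>\<Lambda> \<beta>1) + (n1 * c2 + m2 * s1) *\<^sub>R (\<alpha>1 \<and>\<^sub>\<Lambda> \<beta>2) +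
   (n2 * c1 + m1 * s2) *\<^sub>R (\<alpha>2 \<and>\<^sub>\<Lambda> \<beta>1) + (n2 * c2 + m2 * s2) *\<^sub>R (\<alpha>2 \<and>\<^sub>\<Lambda> \<beta>2) +
   (m1 * c2 - m2 * c1) *\<^sub>R (\<beta>1 \<and>\<^sub>\<Lambda> \<beta>2) + (n2 * s1 - n1 * s2) *\<^sub>R (\<alpha>1 \<and>\<^sub>\<Lambda> \<alpha>2)"
  by (simp add: wedge_def vec_eq_iff algebra_simps)

section \<open>Integrals of products of centred sines and cosines\<close>

lemma has_integral_FTC_real:
  fixes F f :: "real \<Rightarrow> real"
  assumes "\<And>s. (F has_real_derivative f s) (at s)" and "F 1 - F 0 = I"
  shows "(f has_integral I) {0..1}"
  using fundamental_theorem_of_calculus[of 0 1 F f] assms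
  by (auto simp: has_real_derivative_iff_has_vector_derivative intro: has_vector_derivative_at_within)

lemma has_integral_cos_centred:
  "p \<noteq> 0 \<Longrightarrow> ((\<lambda>s::real. cos (p * (2 * s - 1))) has_integral sin p / p) {0..1}"
  by (rule has_integral_FTC_real[OF beta_coeff_deriv]) (auto simp: beta_coeff_def)

lemma has_integral_sin_centred:
  "p \<noteq> 0 \<Longrightarrow> ((\<lambda>s::real. sin (p * (2 * s - 1))) has_integral 0) {0..1}"
  by (rule has_integral_FTC_real[where F = "\<lambda>s. - alpha_coeff p s"])
    (auto simp: alpha_coeff_def intro!: derivative_eq_intros)

text \<open>Products of trigonometric functions have antiderivatives over \<open>2 (p\<^sup>2 - q\<^sup>2)\<close>. Multiplying this
  denominator out first, as the constant \<open>K\<close>, leaves derivatives of polynomials in sine and cosine.\<close>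

lemma has_integral_FTC_scaled:
  fixes F f :: "real \<Rightarrow> real"
  assumes "\<And>s. (F has_real_derivative K * f s) (at s)" and "F 1 - F 0 = K * I" and "K \<noteq> 0"
  shows "(f has_integral I) {0..1}"
proof -
  have "((\<lambda>s. K * f s) has_integral K * I) {0..1}"
    by (rule has_integral_FTC_real[OF assms(1,2)])
  from has_integral_mult_right[OF this, of "1 / K"] show ?thesis
    using assms(3) by simp
qed

lemma has_integral_cos_cos:
  assumes "p\<^sup>2 \<noteq> q\<^sup>2"
  shows "((\<lambda>s::real. cos (p * (2 * s - 1)) * cos (q * (2 * s - 1))) has_integral
    (p * sin p * cos q - q * cos p * sin q) / (p\<^sup>2 - q\<^sup>2)) {0..1}"
proof (rule has_integral_FTC_scaled)
  let ?F = "\<lambda>s. p * sin (p * (2 * s - 1)) * cos (q * (2 * s - 1)) - q * cos (p * (2 * s - 1)) * sin (q * (2 * s - 1))"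
  show "(?F has_real_derivative 2 * (p\<^sup>2 - q\<^sup>2) * (cos (p * (2 * s - 1)) * cos (q * (2 * s - 1)))) (at s)" for s
    by (auto intro!: derivative_eq_intros simp: algebra_simps power2_eq_square)
  show "?F 1 - ?F 0 = 2 * (p\<^sup>2 - q\<^sup>2) * ((p * sin p * cos q - q * cos p * sin q) / (p\<^sup>2 - q\<^sup>2))"
    using assms by (simp del: right_diff_distrib_numeral, simp add: algebra_simps)
qed (use assms in simp)

lemma has_integral_sin_sin:
  assumes "p\<^sup>2 \<noteq> q\<^sup>2"
  shows "((\<lambda>s::real. sin (p * (2 * s - 1)) * sin (q * (2 * s - 1))) has_integral
    (q * sin p * cos q - p * cos p * sin q) / (p\<^sup>2 - q\<^sup>2)) {0..1}"
proof (rule has_integral_FTC_scaled)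
  let ?F = "\<lambda>s. q * sin (p * (2 * s - 1)) * cos (q * (2 * s - 1)) - p * cos (p * (2 * s - 1)) * sin (q * (2 * s - 1))"
  show "(?F has_real_derivative 2 * (p\<^sup>2 - q\<^sup>2) * (sin (p * (2 * s - 1)) * sin (q * (2 * s - 1)))) (at s)" for s
    by (auto intro!: derivative_eq_intros simp: algebra_simps power2_eq_square)
  show "?F 1 - ?F 0 = 2 * (p\<^sup>2 - q\<^sup>2) * ((q * sin p * cos q - p * cos p * sin q) / (p\<^sup>2 - q\<^sup>2))"
    using assms by (simp del: right_diff_distrib_numeral, simp add: algebra_simps)
qed (use assms in simp)

lemma has_integral_sin_cos:
  assumes "p\<^sup>2 \<noteq> q\<^sup>2"
  shows "((\<lambda>s::real. sin (p * (2 * s - 1)) * cos (q * (2 * s - 1))) has_integral 0) {0..1}"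
proof (rule has_integral_FTC_scaled)
  let ?F = "\<lambda>s. - p * cos (p * (2 * s - 1)) * cos (q * (2 * s - 1)) - q * sin (p * (2 * s - 1)) * sin (q * (2 * s - 1))"
  show "(?F has_real_derivative 2 * (p\<^sup>2 - q\<^sup>2) * (sin (p * (2 * s - 1)) * cos (q * (2 * s - 1)))) (at s)" for s
    by (auto intro!: derivative_eq_intros simp: algebra_simps power2_eq_square)
  show "?F 1 - ?F 0 = 2 * (p\<^sup>2 - q\<^sup>2) * 0"
    by simp
qed (use assms in simp)

section \<open>The coefficients of the area form\<close>

text \<open>Equal frequencies need their own computation, as the product integrals above have a pole at
  \<open>p = q\<close>; here \<open>cos\<^sup>2 + sin\<^sup>2 = 1\<close> and the addition theorem leave a single cosine.\<close>

lemma has_integral_alpha_beta_same: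
  assumes "p \<noteq> 0"
  shows "((\<lambda>s. (1/2) * (alpha_coeff p s * cos (p * (2 * s - 1)) +
      beta_coeff p s * sin (p * (2 * s - 1)))) has_integral U p) {0..1}"
proof -
  have "sin (p * 2) = 2 * sin p * cos p"
    using sin_double[of p] by (simp add: mult.commute)
  then have "((\<lambda>s. (1 - cos (2 * p * s)) / (4 * p)) has_integral U p) {0..1}"
    using assms by (intro has_integral_FTC_real[where F = "\<lambda>s. (s - sin (2 * p * s) / (2 * p)) / (4 * p)"])
      (auto intro!: derivative_eq_intros simp: U_def field_simps power2_eq_square)
  moreover have "(1 - cos (2 * p * s)) / (4 * p) = (1/2) * (alpha_coeff p s * cos (p * (2 * s - 1)) +
      beta_coeff p s * sin (p * (2 * s - 1)))" for s
  proof -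
    define \<theta> where "\<theta> = p * (2 * s - 1)"
    have eq: "2 * p * s = \<theta> + p"
      by (simp add: \<theta>_def algebra_simps)
    have one_minus_cos: "1 - cos (\<theta> + p) = (cos \<theta> - cos p) * cos \<theta> + (sin \<theta> + sin p) * sin \<theta>"
      using sin_cos_squared_add[of \<theta>] by (simp add: cos_add power2_eq_square algebra_simps)
    show ?thesis
      unfolding eq one_minus_cos alpha_coeff_def beta_coeff_def \<theta>_def[symmetric]
      using assms by (simp add: field_simps)
  qed
  ultimately show ?thesis
    by simp
qed

text \<open>Both \<open>x\<^sub>1 \<and> u\<^sub>2\<close> and \<open>x\<^sub>2 \<and> u\<^sub>1\<close> contribute to \<open>\<alpha>\<^sub>1 \<and> \<beta>\<^sub>2\<close>; together their even parts give \<open>Z\<close>.\<close>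

lemma has_integral_alpha_beta_mixed:
  assumes "p \<noteq> 0" "q \<noteq> 0" "p\<^sup>2 \<noteq> q\<^sup>2"
  shows "((\<lambda>s. (1/2) * (alpha_coeff p s * cos (q * (2 * s - 1)) +
      beta_coeff q s * sin (p * (2 * s - 1)))) has_integral Z p q) {0..1}"
proof -
  let ?cc = "(p * sin p * cos q - q * cos p * sin q) / (p\<^sup>2 - q\<^sup>2)"
  let ?ss = "(q * sin p * cos q - p * cos p * sin q) / (p\<^sup>2 - q\<^sup>2)"
  have "((\<lambda>s. (1/2) * ((cos (p * (2 * s - 1)) * cos (q * (2 * s - 1)) - cos p * cos (q * (2 * s - 1))) / (2 * p) +
      (sin (p * (2 * s - 1)) * sin (q * (2 * s - 1)) + sin q * sin (p * (2 * s - 1))) / (2 * q))) has_integral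
      (1/2) * ((?cc - cos p * (sin q / q)) / (2 * p) + (?ss + sin q * 0) / (2 * q))) {0..1}"
    by (intro has_integral_mult_right has_integral_add has_integral_diff has_integral_divide
        has_integral_cos_cos has_integral_sin_sin has_integral_cos_centred has_integral_sin_centred assms)
  moreover have "(1/2) * ((?cc - cos p * (sin q / q)) / (2 * p) + (?ss + sin q * 0) / (2 * q)) = Z p q"
  proof -
    \<comment> \<open>Naming the denominator keeps it a nonzero atom while fractions are cleared.\<close>
    define d where "d = p\<^sup>2 - q\<^sup>2"
    have d: "d \<noteq> 0"
      using assms by (simp add: d_def)
    have "(1/2) * (((p * sin p * cos q - q * cos p * sin q) / d - cos p * (sin q / q)) / (2 * p) +
        ((q * sin p * cos q - p * cos p * sin q) / d + sin q * 0) / (2 * q)) =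
        (q * (p * sin p * cos q - q * cos p * sin q) - d * cos p * sin q +
         p * (q * sin p * cos q - p * cos p * sin q)) / (4 * p * q * d)"
      using assms d by (simp add: field_simps)
    also have "\<dots> = (2 * p * (q * cos q * sin p - p * cos p * sin q)) / (4 * p * q * d)"
      by (simp add: d_def power2_eq_square algebra_simps)
    also have "\<dots> = (q * cos q * sin p - p * cos p * sin q) / (2 * q * d)"
      using assms d by (simp add: field_simps)
    finally show ?thesis
      unfolding Z_def d_def .
  qed
  ultimately show ?thesis
    by (simp add: alpha_coeff_def beta_coeff_def algebra_simps)
qed

text \<open>The constants \<open>sin p\<close> and \<open>sin q\<close> in the coefficients are what survives oddness, and their two
  contributions cancel: before halving, both are \<open>sin p sin q / (2 p q)\<close>.\<close>

lemma has_integral_beta_beta: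
  assumes "p \<noteq> 0" "q \<noteq> 0" "p\<^sup>2 \<noteq> q\<^sup>2"
  shows "((\<lambda>s. (1/2) * (beta_coeff p s * cos (q * (2 * s - 1)) -
      beta_coeff q s * cos (p * (2 * s - 1)))) has_integral 0) {0..1}"
proof -
  have "((\<lambda>s. (1/2) * ((sin (p * (2 * s - 1)) * cos (q * (2 * s - 1)) + sin p * cos (q * (2 * s - 1))) / (2 * p) -
      (sin (q * (2 * s - 1)) * cos (p * (2 * s - 1)) + sin q * cos (p * (2 * s - 1))) / (2 * q))) has_integral
      (1/2) * ((0 + sin p * (sin q / q)) / (2 * p) - (0 + sin q * (sin p / p)) / (2 * q))) {0..1}"
    by (intro has_integral_mult_right has_integral_add has_integral_diff has_integral_divide
        has_integral_sin_cos has_integral_cos_centred assms assms(3)[symmetric])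
  then show ?thesis
    by (simp add: beta_coeff_def algebra_simps)
qed

text \<open>The integrand is odd about \<open>1/2\<close>.\<close>

lemma has_integral_alpha_alpha:
  assumes "p \<noteq> 0" "q \<noteq> 0" "p\<^sup>2 \<noteq> q\<^sup>2"
  shows "((\<lambda>s. (1/2) * (alpha_coeff q s * sin (p * (2 * s - 1)) -
      alpha_coeff p s * sin (q * (2 * s - 1)))) has_integral 0) {0..1}"
proof -
  have "((\<lambda>s. (1/2) * ((sin (p * (2 * s - 1)) * cos (q * (2 * s - 1)) - cos q * sin (p * (2 * s - 1))) / (2 * q) -
      (sin (q * (2 * s - 1)) * cos (p * (2 * s - 1)) - cos p * sin (q * (2 * s - 1))) / (2 * p))) has_integral
      (1/2) * ((0 - cos q * 0) / (2 * q) - (0 - cos p * 0) / (2 * p))) {0..1}"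
    by (intro has_integral_mult_right has_integral_diff has_integral_divide
        has_integral_sin_cos has_integral_sin_centred assms assms(3)[symmetric])
  then show ?thesis
    by (simp add: alpha_coeff_def algebra_simps)
qed

section \<open>The endpoint of the extremal\<close>

theorem theorem1p1:
  fixes a1 b1 a2 b2 \<alpha>1 \<beta>1 \<alpha>2 \<beta>2 :: "real^4" and \<phi>1 \<phi>2 :: real
  assumes "orthogonal a1 b1" "orthogonal a1 a2" "orthogonal a1 b2"
    and "orthogonal b1 a2" "orthogonal b1 b2" "orthogonal a2 b2"
    and "norm a1 = norm b1" "norm a2 = norm b2"
    and "\<phi>1 > \<phi>2" "\<phi>2 > 0"
    and "\<alpha>1 = sin \<phi>1 *\<^sub>R a1 - cos \<phi>1 *\<^sub>R b1" "\<beta>1 = cos \<phi>1 *\<^sub>R a1 + sin \<phi>1 *\<^sub>R b1"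
    and "\<alpha>2 = sin \<phi>2 *\<^sub>R a2 - cos \<phi>2 *\<^sub>R b2" "\<beta>2 = cos \<phi>2 *\<^sub>R a2 + sin \<phi>2 *\<^sub>R b2"
  shows "extremal_x 1 (a1, a2) (b1, b2) (\<phi>1, \<phi>2) = T \<phi>1 *\<^sub>R \<beta>1 + T \<phi>2 *\<^sub>R \<beta>2 \<and>
         extremal_t 1 (a1, a2) (b1, b2) (\<phi>1, \<phi>2) =
           U \<phi>1 *\<^sub>R (\<alpha>1 \<and>\<^sub>\<Lambda> \<beta>1) + Z \<phi>1 \<phi>2 *\<^sub>R (\<alpha>1 \<and>\<^sub>\<Lambda> \<beta>2) +
           Z \<phi>2 \<phi>1 *\<^sub>R (\<alpha>2 \<and>\<^sub>\<Lambda> \<beta>1) + U \<phi>2 *\<^sub>R (\<alpha>2 \<and>\<^sub>\<Lambda> \<beta>2)"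
proof -
  let ?u = "extremal_control (a1, a2) (b1, b2) (\<phi>1, \<phi>2)"
  define c where "c p s = cos (p * (2 * s - 1))" for p s :: real
  define d where "d p s = sin (p * (2 * s - 1))" for p s :: real
  define x where "x s = beta_coeff \<phi>1 s *\<^sub>R \<beta>1 + alpha_coeff \<phi>1 s *\<^sub>R \<alpha>1 +
    beta_coeff \<phi>2 s *\<^sub>R \<beta>2 + alpha_coeff \<phi>2 s *\<^sub>R \<alpha>2" for s
  define t where "t = U \<phi>1 *\<^sub>R (\<alpha>1 \<and>\<^sub>\<Lambda> \<beta>1) + Z \<phi>1 \<phi>2 *\<^sub>R (\<alpha>1 \<and>\<^sub>\<Lambda> \<beta>2) +
    Z \<phi>2 \<phi>1 *\<^sub>R (\<alpha>2 \<and>\<^sub>\<Lambda> \<beta>1) + U \<phi>2 *\<^sub>R (\<alpha>2 \<and>\<^sub>\<Lambda> \<beta>2)"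
  have nz: "\<phi>1 \<noteq> 0" "\<phi>2 \<noteq> 0"
    using assms(9,10) by auto
  have "\<phi>2\<^sup>2 < \<phi>1\<^sup>2"
    using assms(9,10) by (intro power_strict_mono) auto
  then have sq: "\<phi>1\<^sup>2 \<noteq> \<phi>2\<^sup>2" "\<phi>2\<^sup>2 \<noteq> \<phi>1\<^sup>2"
    by auto
  have u: "?u s = c \<phi>1 s *\<^sub>R \<beta>1 - d \<phi>1 s *\<^sub>R \<alpha>1 + (c \<phi>2 s *\<^sub>R \<beta>2 - d \<phi>2 s *\<^sub>R \<alpha>2)" for s
    using rotation_centred[of \<phi>1 s a1 b1] rotation_centred[of \<phi>2 s a2 b2]
    by (simp add: extremal_control_def assms(11-14) c_def d_def add.assoc)
  have "associated_curve ?u 1 = (x 1, t)"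
  proof (rule associated_curve_at_1)
    show "continuous_on UNIV ?u"
      unfolding extremal_control_def by (auto intro!: continuous_intros)
    show "x 0 = 0"
      by (simp add: x_def alpha_coeff_def beta_coeff_def)
    show "(x has_vector_derivative ?u s) (at s)" for s
    proof -
      have scaled: "((\<lambda>s. f s *\<^sub>R v) has_vector_derivative f' *\<^sub>R v) (at s)"
        if "(f has_real_derivative f') (at s)" for f f' and v :: "real^4"
        using has_vector_derivative_scaleR[OF that has_vector_derivative_const[of v]] by simp
      have "(x has_vector_derivative c \<phi>1 s *\<^sub>R \<beta>1 + (- d \<phi>1 s) *\<^sub>R \<alpha>1 +
          c \<phi>2 s *\<^sub>R \<beta>2 + (- d \<phi>2 s) *\<^sub>R \<alpha>2) (at s)"
        unfolding x_def c_def d_def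
        by (intro has_vector_derivative_add scaled beta_coeff_deriv alpha_coeff_deriv nz)
      then show ?thesis
        by (simp add: u add_diff_eq)
    qed
    have "((\<lambda>s.
        ((1/2) * (alpha_coeff \<phi>1 s * c \<phi>1 s + beta_coeff \<phi>1 s * d \<phi>1 s)) *\<^sub>R (\<alpha>1 \<and>\<^sub>\<Lambda> \<beta>1) +
        ((1/2) * (alpha_coeff \<phi>1 s * c \<phi>2 s + beta_coeff \<phi>2 s * d \<phi>1 s)) *\<^sub>R (\<alpha>1 \<and>\<^sub>\<Lambda> \<beta>2) +
        ((1/2) * (alpha_coeff \<phi>2 s * c \<phi>1 s + beta_coeff \<phi>1 s * d \<phi>2 s)) *\<^sub>R (\<alpha>2 \<and>\<^sub>\<Lambda> \<beta>1) +
        ((1/2) * (alpha_coeff \<phi>2 s * c \<phi>2 s + beta_coeff \<phi>2 s * d \<phi>2 s)) *\<^sub>R (\<alpha>2 \<and>\<^sub>\<Lambda> \<beta>2) +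
        ((1/2) * (beta_coeff \<phi>1 s * c \<phi>2 s - beta_coeff \<phi>2 s * c \<phi>1 s)) *\<^sub>R (\<beta>1 \<and>\<^sub>\<Lambda> \<beta>2) +
        ((1/2) * (alpha_coeff \<phi>2 s * d \<phi>1 s - alpha_coeff \<phi>1 s * d \<phi>2 s)) *\<^sub>R (\<alpha>1 \<and>\<^sub>\<Lambda> \<alpha>2))
      has_integral t + 0 *\<^sub>R (\<beta>1 \<and>\<^sub>\<Lambda> \<beta>2) + 0 *\<^sub>R (\<alpha>1 \<and>\<^sub>\<Lambda> \<alpha>2)) {0..1}"
      unfolding t_def c_def d_def
      by (intro has_integral_add has_integral_scaleR_left has_integral_alpha_beta_same
          has_integral_alpha_beta_mixed has_integral_beta_beta has_integral_alpha_alpha nz sq)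
    then show "((\<lambda>s. (1/2) *\<^sub>R (x s \<and>\<^sub>\<Lambda> ?u s)) has_integral t) {0..1}"
      unfolding u x_def wedge_expansion by (simp add: scaleR_add_right)
  qed
  moreover have "x 1 = T \<phi>1 *\<^sub>R \<beta>1 + T \<phi>2 *\<^sub>R \<beta>2"
    by (simp add: x_def alpha_coeff_def beta_coeff_def T_def)
  ultimately show ?thesis
    by (simp add: extremal_x_def extremal_t_def extremal_def t_def)
qed

end
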